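(* Let $n,m_1,m_2$ be nonnegative integers. Let $C_1(m_1,m_2,n)$ be the number of partitions of $n$ into parts congruent to $0,1,3,$ or $5\pmod 6$ with exactly $m_1$ parts congruent to $1\pmod 6$ and exactly $m_2$ parts congruent to $5\pmod 6$. Let $C_2(m_1,m_2,n)$ be the number of partitions of $n$ satisfying: (a) if two adjacent parts differ by exactly $1$, the smaller is not $\equiv1\pmod3$; (b) if two adjacent parts differ by exactly $2$, the smaller is $\equiv2\pmod3$; (c) no part equals $2$; (d) there are exactly $m_1$ parts congruent to $1\pmod 3$ and exactly $m_2$ parts congruent to $2\pmod 3$. Then $C_1(m_1,m_2,n)=C_2(m_1,m_2,n)$.
   Context: Partitions are written in nonincreasing order; "adjacent parts" means $\lambda_j$ and $\lambda_{j+1}$ in that ordering. Numbers of parts in a residue class are counted with multiplicity. *)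

theory Defs
  imports Main
begin

definition is_partition :: "nat \<Rightarrow> nat list \<Rightarrow> bool" where
  "is_partition n ps \<longleftrightarrow> sorted_wrt (\<ge>) ps \<and> (\<forall>p\<in>set ps. 0 < p) \<and> sum_list ps = n"

definition num_parts_mod :: "nat \<Rightarrow> nat \<Rightarrow> nat list \<Rightarrow> nat" where
  "num_parts_mod m r ps = length (filter (\<lambda>p. p mod m = r) ps)"

definition C1 :: "nat \<Rightarrow> nat \<Rightarrow> nat \<Rightarrow> nat" where
  "C1 m1 m2 n = card {ps. is_partition n ps
      \<and> (\<forall>p\<in>set ps. p mod 6 \<in> {0, 1, 3, 5})
      \<and> num_parts_mod 6 1 ps = m1 \<and> num_parts_mod 6 5 ps = m2}"

definition C2 :: "nat \<Rightarrow> nat \<Rightarrow> nat \<Rightarrow> nat" where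
  "C2 m1 m2 n = card {ps. is_partition n ps
      \<and> (\<forall>j. Suc j < length ps \<longrightarrow>
            (ps!j = ps!(Suc j) + 1 \<longrightarrow> ps!(Suc j) mod 3 \<noteq> 1)
          \<and> (ps!j = ps!(Suc j) + 2 \<longrightarrow> ps!(Suc j) mod 3 = 2))
      \<and> 2 \<notin> set ps
      \<and> num_parts_mod 3 1 ps = m1 \<and> num_parts_mod 3 2 ps = m2}"

end

theory Submission
  imports Defs "HOL-Library.Multiset"
begin

text \<open>
  Write every part as \<open>3 k + \<epsilon>\<close> with \<open>\<epsilon> \<in> {-1, 0, 1}\<close>. Read from the smallest part upwards and
  started at a virtual part \<open>0\<close>, the conditions (a)--(c) say that \<open>k\<close> is nondecreasing and
  increases by at least \<open>d = 2\<close> wherever \<open>\<epsilon>\<close> descends. Subtracting these forced jumps from the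
  \<open>k\<close>'s splits such a partition into a word in the letters \<open>\<epsilon>\<close>, weighted by \<open>d\<close> times a comajor
  index, and an arbitrary partition. On the other side, a partition into parts \<open>3 j\<close> and
  \<open>3 d k \<plusminus> 1\<close> splits into a multiset of parts \<open>3 k \<plusminus> 1\<close>, weighted by \<open>d\<close> times the sum of the
  \<open>k\<close>'s, and an arbitrary partition. For \<open>d = 1\<close> both conditions are void, so both sides count the
  same partitions; cancelling the arbitrary partition from this identity shows that words and
  multisets are equidistributed, and hence the two sides agree for every \<open>d \<ge> 1\<close>.
\<close>


section \<open>Convolutions, sorted lists and multisets\<close>

lemma convolution_cancel:
  fixes u v p :: "nat \<Rightarrow> 'a :: {semiring_0_cancel, semiring_no_zero_divisors_cancel}"
  assumes "p 0 \<noteq> 0"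
    and eq: "\<And>k. k \<le> n \<Longrightarrow> (\<Sum>c\<le>k. u c * p (k - c)) = (\<Sum>c\<le>k. v c * p (k - c))"
    and "k \<le> n"
  shows "u k = v k"
  using \<open>k \<le> n\<close>
proof (induction k rule: less_induct)
  case (less k)
  have "(\<Sum>c<k. u c * p (k - c)) = (\<Sum>c<k. v c * p (k - c))"
    using less by (intro sum.cong) auto
  moreover have "(\<Sum>c\<le>k. w c * p (k - c)) = (\<Sum>c<k. w c * p (k - c)) + w k * p 0" for w
    by (simp flip: lessThan_Suc_atMost)
  ultimately show ?case
    using eq[OF less.prems] \<open>p 0 \<noteq> 0\<close> by simp
qed

lemma card_weighted_decomposition:
  fixes weight :: "'a \<Rightarrow> nat"
  assumes "0 < d" and fin: "\<And>c. finite (S c)" "\<And>j. finite (T j)"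
    and weight: "\<And>c u. u \<in> S c \<Longrightarrow> weight u = c"
    and split: "\<And>x. x \<in> X \<Longrightarrow> \<exists>c j. f x \<in> S c \<and> g x \<in> T j \<and> d * c + j = K"
    and join: "\<And>c j u v. u \<in> S c \<Longrightarrow> v \<in> T j \<Longrightarrow> d * c + j = K \<Longrightarrow> join u v \<in> X"
    and join_split: "\<And>x. x \<in> X \<Longrightarrow> join (f x) (g x) = x"
    and split_join: "\<And>c j u v. u \<in> S c \<Longrightarrow> v \<in> T j \<Longrightarrow> f (join u v) = u \<and> g (join u v) = v"
  shows "card X = (\<Sum>c\<le>K div d. card (S c) * card (T (K - d * c)))"
proof -
  let ?pairs = "SIGMA c:{..K div d}. S c \<times> T (K - d * c)"
  have le_div: "c \<le> K div d \<longleftrightarrow> d * c \<le> K" for c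
    using \<open>0 < d\<close> by (simp add: less_eq_div_iff_mult_less_eq mult.commute)
  have "bij_betw (\<lambda>x. (weight (f x), f x, g x)) X ?pairs"
  proof (rule bij_betw_byWitness[where f' = "\<lambda>(c, u, v). join u v"])
    show "\<forall>x\<in>X. (case (weight (f x), f x, g x) of (c, u, v) \<Rightarrow> join u v) = x"
      using join_split by simp
    show "\<forall>z\<in>?pairs. (weight (f (case z of (c, u, v) \<Rightarrow> join u v)),
        f (case z of (c, u, v) \<Rightarrow> join u v), g (case z of (c, u, v) \<Rightarrow> join u v)) = z"
      using split_join weight by auto
    show "(\<lambda>x. (weight (f x), f x, g x)) ` X \<subseteq> ?pairs"
    proof (rule image_subsetI)
      fix x
      assume "x \<in> X"
      then obtain c j where "f x \<in> S c" "g x \<in> T j" "d * c + j = K"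
        using split by blast
      moreover from this have "d * c \<le> K" "K - d * c = j"
        by auto
      ultimately show "(weight (f x), f x, g x) \<in> ?pairs"
        using weight by (simp add: le_div)
    qed
    show "(\<lambda>(c, u, v). join u v) ` ?pairs \<subseteq> X"
      using join by (auto simp: le_div)
  qed
  then have "card X = card ?pairs"
    by (rule bij_betw_same_card)
  then show ?thesis
    by (simp add: fin card_cartesian_product)
qed

lemma sorted_wrt_snoc_Cons:
  assumes "transp P"
  shows "sorted_wrt P ((x # xs) @ [z]) \<longleftrightarrow> P x (hd (xs @ [z])) \<and> sorted_wrt P (xs @ [z])"
  unfolding successively_conv_sorted_wrt[OF assms, symmetric] by (simp add: successively_Cons)

lemma card_sorted_desc_lists:
  fixes Q :: "'a::linorder multiset \<Rightarrow> bool"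
  shows "card {ps. sorted_wrt (\<ge>) ps \<and> Q (mset ps)} = card {M. Q M}"
proof (rule bij_betw_same_card[where f = mset],
    rule bij_betw_byWitness[where f' = "\<lambda>M. rev (sorted_list_of_multiset M)"])
  show "\<forall>ps\<in>{ps. sorted_wrt (\<ge>) ps \<and> Q (mset ps)}. rev (sorted_list_of_multiset (mset ps)) = ps"
  proof clarify
    fix ps :: "'a list"
    assume "sorted_wrt (\<ge>) ps"
    then have "sorted (rev ps)"
      by (simp add: sorted_wrt_rev)
    then have "sorted_list_of_multiset (mset ps) = rev ps"
      by (metis mset_rev sorted_list_of_multiset_mset sorted_sort_id)
    then show "rev (sorted_list_of_multiset (mset ps)) = ps"
      by simp
  qed
qed (auto simp: sorted_wrt_rev)

lemma sorted_desc_filter_append_zeros: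
  fixes xs :: "nat list"
  assumes "sorted_wrt (\<ge>) xs"
  shows "filter (\<lambda>x. x \<noteq> 0) xs @ replicate (count_list xs 0) 0 = xs"
  using assms
proof (induction xs)
  case (Cons x xs)
  show ?case
  proof (cases "x = 0")
    case True
    then have "filter (\<lambda>x. x \<noteq> 0) xs = []"
      using Cons.prems by auto
    then show ?thesis
      using Cons True by simp
  qed (use Cons in auto)
qed simp

lemma card_sorted_desc_pad_zeros:
  fixes Q :: "nat list \<Rightarrow> bool"
  assumes pad: "\<And>ps m. Q (ps @ replicate m 0) \<longleftrightarrow> Q ps"
    and len: "\<And>ps. 0 \<notin> set ps \<Longrightarrow> Q ps \<Longrightarrow> length ps \<le> N"
  shows "card {ps. sorted_wrt (\<ge>) ps \<and> 0 \<notin> set ps \<and> Q ps} =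
    card {xs. sorted_wrt (\<ge>) xs \<and> length xs = N \<and> Q xs}"
proof (rule bij_betw_same_card[where f = "\<lambda>ps. ps @ replicate (N - length ps) 0"],
    rule bij_betw_byWitness[where f' = "filter (\<lambda>x. x \<noteq> 0)"])
  let ?unpadded = "{ps. sorted_wrt (\<ge>) ps \<and> 0 \<notin> set ps \<and> Q ps}"
  let ?padded = "{xs. sorted_wrt (\<ge>) xs \<and> length xs = N \<and> Q xs}"
  show "\<forall>xs\<in>?padded. filter (\<lambda>x. x \<noteq> 0) xs @ replicate (N - length (filter (\<lambda>x. x \<noteq> 0) xs)) 0 = xs"
    using sorted_desc_filter_append_zeros
    by (metis (mono_tags, lifting) add_diff_cancel_left' length_append length_replicate
        mem_Collect_eq)
  show "filter (\<lambda>x. x \<noteq> 0) ` ?padded \<subseteq> ?unpadded"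
    using sorted_desc_filter_append_zeros pad by (auto simp: sorted_wrt_filter) metis
  show "\<forall>ps\<in>?unpadded. filter (\<lambda>x. x \<noteq> 0) (ps @ replicate (N - length ps) 0) = ps"
    by (auto simp: filter_id_conv intro: ccontr)
  have "sorted_wrt (\<ge>) (replicate m (0 :: nat))" for m
    by (induction m) auto
  then show "(\<lambda>ps. ps @ replicate (N - length ps) 0) ` ?unpadded \<subseteq> ?padded"
    using len pad by (auto simp: sorted_wrt_append)
qed

lemma size_le_sum_mset:
  fixes M :: "nat multiset"
  assumes "0 \<notin># M"
  shows "size M \<le> sum_mset M"
  using assms by (induction M) auto


section \<open>Blocks, letters and profiles\<close>

text \<open>
  In \<open>x = 3 k + \<epsilon>\<close>, \<open>block x\<close> is \<open>k\<close> and \<open>letter x\<close> is \<open>\<epsilon> + 1\<close>, so the neutral letter is \<open>1\<close>. The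
  truncated subtraction in \<open>part k e\<close> matters only for \<open>k = e = 0\<close>.
\<close>

definition block :: "nat \<Rightarrow> nat" where
  "block x = (x + 1) div 3"

definition letter :: "nat \<Rightarrow> nat" where
  "letter x = (x + 1) mod 3"

definition part :: "nat \<Rightarrow> nat \<Rightarrow> nat" where
  "part k e = 3 * k + e - 1"

lemma block_0 [simp]: "block 0 = 0"
  by (simp add: block_def)

lemma letter_0 [simp]: "letter 0 = 1"
  by (simp add: letter_def)

lemma letter_le_2: "letter x \<le> 2"
  by (simp add: letter_def flip: less_Suc_eq_le)

lemma block_letter: "3 * block x + letter x = x + 1"
  by (simp add: block_def letter_def)

lemma block_add_letter_pos: "0 < block x + letter x"
  using block_letter[of x] by linarith

lemma part_block_letter [simp]: "part (block x) (letter x) = x"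
  by (simp add: part_def block_letter)

lemma
  assumes "e \<le> 2" "0 < k + e"
  shows block_part: "block (part k e) = k" and letter_part: "letter (part k e) = e"
proof -
  have "part k e + 1 = 3 * k + e"
    using assms(2) by (simp add: part_def)
  then show "block (part k e) = k" "letter (part k e) = e"
    using assms(1) unfolding block_def letter_def by auto
qed

lemma letter_eq_2_iff: "letter x = 2 \<longleftrightarrow> x mod 3 = 1"
  unfolding letter_def by presburger

lemma letter_eq_0_iff: "letter x = 0 \<longleftrightarrow> x mod 3 = 2"
  unfolding letter_def by presburger

abbreviation letter_count :: "nat \<Rightarrow> nat multiset \<Rightarrow> nat" where
  "letter_count e M \<equiv> count (image_mset letter M) e"

abbreviation block_sum :: "nat multiset \<Rightarrow> nat" where
  "block_sum M \<equiv> sum_mset (image_mset block M)"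

definition has_profile :: "nat \<Rightarrow> nat \<Rightarrow> nat \<Rightarrow> nat multiset \<Rightarrow> bool" where
  "has_profile a b K M \<longleftrightarrow> letter_count 2 M = a \<and> letter_count 0 M = b \<and> block_sum M = K"

lemma sum_mset_eq_block_sum:
  "sum_mset M + letter_count 0 M = 3 * block_sum M + letter_count 2 M"
proof (induction M)
  case (add x M)
  have "x + of_bool (letter x = 0) = 3 * block x + of_bool (letter x = 2)"
    using block_letter[of x] letter_le_2[of x]
    by (cases "letter x = 1") (auto simp: le_Suc_eq numeral_2_eq_2)
  then show ?case
    using add by (cases "letter x = 0"; cases "letter x = 2") simp_all
qed simp

lemma has_profile_imp_sum: "has_profile a b K M \<Longrightarrow> sum_mset M + b = 3 * K + a"
  using sum_mset_eq_block_sum[of M] by (simp add: has_profile_def)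

lemma has_profile_add_zeros:
  "has_profile a b K (M + replicate_mset m 0) \<longleftrightarrow> has_profile a b K M"
  by (simp add: has_profile_def)

definition partitions :: "nat \<Rightarrow> nat multiset set" where
  "partitions n = {L. 0 \<notin># L \<and> sum_mset L = n}"

lemma finite_partitions: "finite (partitions n)"
proof (rule finite_subset)
  show "partitions n \<subseteq> (\<Union>m\<le>n. multisets_of_size {..n} m)"
    using size_le_sum_mset sum_mset.remove
    by (fastforce simp: partitions_def multisets_of_size_def)
qed auto

lemma partitions_0: "partitions 0 = {{#}}"
proof -
  have "L = {#}" if "0 \<notin># L" "sum_mset L = 0" for L :: "nat multiset"
    using size_le_sum_mset[OF that(1)] that(2) by simp
  then show ?thesis
    by (auto simp: partitions_def)
qed


section \<open>Partitions into multiples of 3 and stretched parts\<close>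

definition scaled_partitions :: "nat \<Rightarrow> nat \<Rightarrow> nat \<Rightarrow> nat \<Rightarrow> nat multiset set" where
  "scaled_partitions d a b K =
    {M. 0 \<notin># M \<and> has_profile a b K M \<and> (\<forall>x\<in>#M. letter x = 1 \<or> d dvd block x)}"

definition nonneutral_multisets :: "nat \<Rightarrow> nat \<Rightarrow> nat \<Rightarrow> nat multiset set" where
  "nonneutral_multisets a b c = {U. has_profile a b c U \<and> (\<forall>x\<in>#U. letter x \<noteq> 1)}"

definition stretch :: "nat \<Rightarrow> nat \<Rightarrow> nat" where
  "stretch d x = part (d * block x) (letter x)"

definition shrink :: "nat \<Rightarrow> nat \<Rightarrow> nat" where
  "shrink d x = part (block x div d) (letter x)"

definition merge :: "nat \<Rightarrow> nat multiset \<Rightarrow> nat multiset \<Rightarrow> nat multiset" where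
  "merge d U L = image_mset (stretch d) U + image_mset (\<lambda>k. part k 1) L"

definition shrunk_nonneutral :: "nat \<Rightarrow> nat multiset \<Rightarrow> nat multiset" where
  "shrunk_nonneutral d M = image_mset (shrink d) {#x \<in># M. letter x \<noteq> 1#}"

definition neutral_blocks :: "nat multiset \<Rightarrow> nat multiset" where
  "neutral_blocks M = image_mset block {#x \<in># M. letter x = 1#}"

lemma
  assumes "0 < d"
  shows block_stretch: "block (stretch d x) = d * block x"
    and letter_stretch: "letter (stretch d x) = letter x"
    and shrink_stretch: "shrink d (stretch d x) = x"
proof -
  have "0 < d * block x + letter x"
    using assms block_add_letter_pos[of x] by auto
  then show "block (stretch d x) = d * block x" "letter (stretch d x) = letter x"
    unfolding stretch_def by (simp_all add: block_part letter_part letter_le_2)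
  then show "shrink d (stretch d x) = x"
    using assms by (simp add: shrink_def)
qed

lemma
  assumes "0 < d" "d dvd block x"
  shows stretch_shrink: "stretch d (shrink d x) = x"
    and letter_shrink: "letter (shrink d x) = letter x"
proof -
  have "0 < block x div d + letter x"
    using assms block_add_letter_pos[of x] by auto
  then have "block (shrink d x) = block x div d" "letter (shrink d x) = letter x"
    unfolding shrink_def by (simp_all add: block_part letter_part letter_le_2)
  then show "stretch d (shrink d x) = x" "letter (shrink d x) = letter x"
    using assms(2) by (simp_all add: stretch_def)
qed

lemma count_letter_merge:
  assumes "0 < d" "e \<noteq> 1"
  shows "letter_count e (merge d U L) = letter_count e U"
  using assms
  by (simp add: merge_def multiset.map_comp comp_def letter_stretch letter_part image_mset_const_eq)

lemma sum_block_merge: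
  assumes "0 < d"
  shows "block_sum (merge d U L) = d * block_sum U + sum_mset L"
  using assms
  by (simp add: merge_def multiset.map_comp comp_def block_stretch block_part sum_mset_distrib_left)

lemma shrunk_nonneutral_merge:
  assumes "0 < d" "\<forall>x\<in>#U. letter x \<noteq> 1"
  shows "shrunk_nonneutral d (merge d U L) = U"
proof -
  have "{#x \<in># U. letter x \<noteq> 1#} = U"
    using assms(2) by (induction U) auto
  then show ?thesis
    using assms(1)
    by (simp add: shrunk_nonneutral_def merge_def filter_mset_image_mset letter_stretch letter_part
        multiset.map_comp comp_def shrink_stretch)
qed

lemma neutral_blocks_merge:
  assumes "0 < d" "\<forall>x\<in>#U. letter x \<noteq> 1"
  shows "neutral_blocks (merge d U L) = L"
proof -
  have "{#x \<in># U. letter x = 1#} = {#}"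
    using assms(2) by simp
  then show ?thesis
    using assms(1)
    by (simp add: neutral_blocks_def merge_def filter_mset_image_mset letter_stretch letter_part
        multiset.map_comp comp_def block_part)
qed

lemma merge_shrunk_nonneutral_neutral_blocks:
  assumes "0 < d" "\<forall>x\<in>#M. letter x = 1 \<or> d dvd block x"
  shows "merge d (shrunk_nonneutral d M) (neutral_blocks M) = M"
proof -
  have neutral: "part (block x) 1 = x" if "letter x = 1" for x
    using part_block_letter[of x] that by metis
  have "image_mset (\<lambda>x. stretch d (shrink d x)) {#x \<in># M. letter x \<noteq> 1#} =
      {#x \<in># M. letter x \<noteq> 1#}"
    using assms by (intro multiset.map_ident_strong) (auto simp: stretch_shrink)
  moreover have "image_mset (\<lambda>x. part (block x) 1) {#x \<in># M. letter x = 1#} =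
      {#x \<in># M. letter x = 1#}"
    using neutral by (intro multiset.map_ident_strong) (simp del: One_nat_def)
  ultimately show ?thesis
    using multiset_partition[of M "\<lambda>x. letter x \<noteq> 1"]
    by (simp add: merge_def shrunk_nonneutral_def neutral_blocks_def multiset.map_comp comp_def)
qed

lemma merge_in_scaled_partitions:
  assumes "0 < d" "U \<in> nonneutral_multisets a b c" "L \<in> partitions j"
  shows "merge d U L \<in> scaled_partitions d a b (d * c + j)"
proof -
  have "x \<noteq> 0 \<and> (letter x = 1 \<or> d dvd block x)" if x: "x \<in># merge d U L" for x
  proof -
    consider u where "u \<in># U" "x = stretch d u" | k where "k \<in># L" "x = part k 1"
      using x by (auto simp: merge_def)
    then show ?thesis
    proof cases
      case 1
      then have "letter x \<noteq> 1" "d dvd block x"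
        using assms by (auto simp: nonneutral_multisets_def letter_stretch block_stretch)
      then show ?thesis
        using letter_0 by metis
    next
      case 2
      then have "letter x = 1" "block x \<noteq> 0"
        using assms(3) by (auto simp: partitions_def letter_part block_part intro: ccontr)
      then show ?thesis
        using block_0 by metis
    qed
  qed
  moreover have "has_profile a b (d * c + j) (merge d U L)"
    using assms
    by (simp add: nonneutral_multisets_def partitions_def has_profile_def count_letter_merge
        sum_block_merge)
  ultimately show ?thesis
    unfolding scaled_partitions_def by blast
qed

lemma scaled_partition_decomposition:
  assumes "0 < d" "M \<in> scaled_partitions d a b K"
  shows "\<exists>c j. shrunk_nonneutral d M \<in> nonneutral_multisets a b c \<and>
    neutral_blocks M \<in> partitions j \<and> d * c + j = K"
proof -
  let ?U = "shrunk_nonneutral d M" and ?L = "neutral_blocks M"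
  let ?c = "block_sum ?U"
  have M: "0 \<notin># M" "has_profile a b K M" "\<forall>x\<in>#M. letter x = 1 \<or> d dvd block x"
    using assms(2) by (auto simp: scaled_partitions_def)
  have merge: "merge d ?U ?L = M"
    by (rule merge_shrunk_nonneutral_neutral_blocks[OF assms(1) M(3)])
  have "d * ?c + sum_mset ?L = K"
    using sum_block_merge[OF assms(1), of ?U ?L] M(2) unfolding merge by (simp add: has_profile_def)
  moreover have "has_profile a b ?c ?U"
    using count_letter_merge[OF assms(1), of _ ?U ?L] M(2)
    unfolding merge by (simp add: has_profile_def)
  moreover have "letter x \<noteq> 1" if "x \<in># ?U" for x
    using that M(3) assms(1) by (auto simp: shrunk_nonneutral_def letter_shrink)
  moreover have "0 \<notin># ?L"
  proof -
    have "block x \<noteq> 0" if "x \<in># M" "letter x = 1" for x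
      using that M(1) block_letter[of x] by (cases "x = 0") auto
    then show ?thesis
      by (fastforce simp: neutral_blocks_def)
  qed
  ultimately show ?thesis
    by (auto simp: nonneutral_multisets_def partitions_def)
qed

lemma finite_nonneutral_multisets: "finite (nonneutral_multisets a b c)"
proof (rule finite_subset[OF _ finite_partitions])
  show "nonneutral_multisets a b c \<subseteq> partitions (3 * c + a - b)"
    by (auto simp: nonneutral_multisets_def partitions_def dest!: has_profile_imp_sum)
qed

lemma card_scaled_partitions:
  assumes "0 < d"
  shows "card (scaled_partitions d a b K) =
    (\<Sum>c\<le>K div d. card (nonneutral_multisets a b c) * card (partitions (K - d * c)))"
proof (rule card_weighted_decomposition[where weight = block_sum
      and join = "merge d" and f = "shrunk_nonneutral d" and g = neutral_blocks])
  show "merge d (shrunk_nonneutral d M) (neutral_blocks M) = M"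
    if "M \<in> scaled_partitions d a b K" for M
    using merge_shrunk_nonneutral_neutral_blocks[OF assms] that by (simp add: scaled_partitions_def)
  show "shrunk_nonneutral d (merge d U L) = U \<and> neutral_blocks (merge d U L) = L"
    if "U \<in> nonneutral_multisets a b c" for c U L
    using shrunk_nonneutral_merge[OF assms] neutral_blocks_merge[OF assms] that
    by (simp add: nonneutral_multisets_def)
  show "merge d U L \<in> scaled_partitions d a b K"
    if "U \<in> nonneutral_multisets a b c" "L \<in> partitions j" "d * c + j = K" for c j U L
    using merge_in_scaled_partitions[OF assms that(1,2)] that(3) by simp
  show "block_sum U = c" if "U \<in> nonneutral_multisets a b c" for c U
    using that by (simp add: nonneutral_multisets_def has_profile_def)
  show "\<exists>c j. shrunk_nonneutral d M \<in> nonneutral_multisets a b c \<and>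
      neutral_blocks M \<in> partitions j \<and> d * c + j = K" if "M \<in> scaled_partitions d a b K" for M
    by (rule scaled_partition_decomposition[OF assms that])
qed (simp_all add: assms finite_nonneutral_multisets finite_partitions)


section \<open>Spaced partitions\<close>

definition dominates :: "nat \<Rightarrow> nat \<Rightarrow> nat \<Rightarrow> bool" where
  "dominates d x y \<longleftrightarrow> block y + d * of_bool (letter x < letter y) \<le> block x"

text \<open>
  The appended \<open>0\<close> is a virtual smallest part. It forces parts with letter \<open>0\<close> to have block at
  least \<open>d\<close>; for \<open>d = 2\<close> this says that \<open>2\<close> is not a part.
\<close>

definition spaced :: "nat \<Rightarrow> nat list \<Rightarrow> bool" where
  "spaced d xs \<longleftrightarrow> sorted_wrt (dominates d) (xs @ [0])"

definition spaced_partitions :: "nat \<Rightarrow> nat \<Rightarrow> nat \<Rightarrow> nat \<Rightarrow> nat list set" where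
  "spaced_partitions d a b K = {ps. 0 \<notin> set ps \<and> has_profile a b K (mset ps) \<and> spaced d ps}"

lemma transp_dominates: "transp (dominates d)"
proof (rule transpI)
  fix x y z
  assume "dominates d x y" "dominates d y z"
  then show "dominates d x z"
    unfolding dominates_def
    by (cases "letter x < letter y"; cases "letter y < letter z"; cases "letter x < letter z") auto
qed

lemma dominates_imp_ge:
  assumes "0 < d" "dominates d x y"
  shows "y \<le> x"
  using assms block_letter[of x] block_letter[of y] letter_le_2[of y]
  by (cases "letter x < letter y") (auto simp: dominates_def)

lemma dominates_1_iff: "dominates 1 x y \<longleftrightarrow> y \<le> x"
proof
  assume "y \<le> x"
  then show "dominates 1 x y"
    using block_letter[of x] block_letter[of y] letter_le_2[of x] letter_le_2[of y]
    by (cases "letter x < letter y") (auto simp: dominates_def)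
qed (rule dominates_imp_ge[of 1], simp)

lemma spaced_Nil [simp]: "spaced d []"
  by (simp add: spaced_def)

lemma spaced_Cons: "spaced d (x # xs) \<longleftrightarrow> dominates d x (hd (xs @ [0])) \<and> spaced d xs"
  unfolding spaced_def by (rule sorted_wrt_snoc_Cons[OF transp_dominates])

lemma spaced_imp_sorted_desc:
  assumes "0 < d" "spaced d xs"
  shows "sorted_wrt (\<ge>) xs"
  using sorted_wrt_mono_rel[of xs "dominates d" "(\<ge>)"] dominates_imp_ge[OF assms(1)] assms(2)
  by (simp add: spaced_def sorted_wrt_append)

lemma spaced_1_iff: "spaced 1 xs \<longleftrightarrow> sorted_wrt (\<ge>) xs"
proof -
  have "dominates 1 = (\<ge>)"
    by (intro ext) (simp only: dominates_1_iff)
  then show ?thesis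
    by (simp add: spaced_def sorted_wrt_append)
qed

lemma spaced_append_zeros: "spaced d (ps @ replicate m 0) \<longleftrightarrow> spaced d ps"
proof (cases m)
  case (Suc k)
  have "dominates d 0 0"
    by (simp add: dominates_def)
  then have "sorted_wrt (dominates d) (replicate m 0 @ [0])" for m
    by (induction m) auto
  then show ?thesis
    using Suc by (auto simp: spaced_def sorted_wrt_append)
qed simp


section \<open>Words and their comajor index\<close>

text \<open>
  Words list the letters of a partition from the largest part down, and descents are read from
  right to left, starting at the letter \<open>1\<close> of the virtual smallest part \<open>0\<close>. Padding partitions
  with zeros gives all words a common length \<open>N\<close>.
\<close>

fun des :: "nat list \<Rightarrow> nat" where
  "des [] = 0"
| "des (e # w) = des w + of_bool (e < hd (w @ [1]))"

fun comaj :: "nat list \<Rightarrow> nat" where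
  "comaj [] = 0"
| "comaj (e # w) = des (e # w) + comaj w"

definition words :: "nat \<Rightarrow> nat \<Rightarrow> nat \<Rightarrow> nat \<Rightarrow> nat list set" where
  "words N a b c =
    {w. length w = N \<and> set w \<subseteq> {..2} \<and> count_list w 2 = a \<and> count_list w 0 = b \<and> comaj w = c}"

definition desc_lists :: "nat \<Rightarrow> nat \<Rightarrow> nat list set" where
  "desc_lists N j = {p. sorted_wrt (\<ge>) p \<and> length p = N \<and> sum_list p = j}"

fun excess :: "nat \<Rightarrow> nat list \<Rightarrow> nat list" where
  "excess d [] = []"
| "excess d (x # xs) = (block x - d * des (map letter (x # xs))) # excess d xs"

fun assemble :: "nat \<Rightarrow> nat list \<Rightarrow> nat list \<Rightarrow> nat list" where
  "assemble d (e # w) (p # ps) = part (p + d * des (e # w)) e # assemble d w ps"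
| "assemble d _ _ = []"

lemma hd_map_letter: "hd (map letter xs @ [1]) = letter (hd (xs @ [0]))"
  by (cases xs) auto

lemma sorted_desc_Cons_iff:
  fixes x :: nat
  shows "sorted_wrt (\<ge>) (x # xs) \<longleftrightarrow> hd (xs @ [0]) \<le> x \<and> sorted_wrt (\<ge>) xs"
  using sorted_wrt_snoc_Cons[of "(\<ge>)" x xs 0] by (simp add: sorted_wrt_append)

lemma spaced_des_le: "spaced d xs \<Longrightarrow> d * des (map letter xs) \<le> block (hd (xs @ [0]))"
  by (induction xs) (auto simp: spaced_Cons dominates_def hd_map_letter[simplified] algebra_simps)

lemma length_excess [simp]: "length (excess d xs) = length xs"
  by (induction xs) auto

lemma sorted_desc_excess: "spaced d xs \<Longrightarrow> sorted_wrt (\<ge>) (excess d xs)"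
proof (induction xs)
  case (Cons x xs)
  have "hd (excess d xs @ [0]) = block (hd (xs @ [0])) - d * des (map letter xs)"
    by (cases xs) auto
  then show ?case
    using Cons spaced_des_le[of d xs] unfolding excess.simps sorted_desc_Cons_iff
    by (auto simp: spaced_Cons dominates_def hd_map_letter[simplified] algebra_simps)
qed simp

lemma sum_list_block:
  "spaced d xs \<Longrightarrow> sum_list (map block xs) = d * comaj (map letter xs) + sum_list (excess d xs)"
proof (induction xs)
  case (Cons x xs)
  then show ?case
    using spaced_des_le[OF Cons.prems] by (auto simp: spaced_Cons algebra_simps)
qed simp

lemma assemble_excess: "spaced d xs \<Longrightarrow> assemble d (map letter xs) (excess d xs) = xs"
proof (induction xs)
  case (Cons x xs)
  have "d * des (map letter (x # xs)) \<le> block x"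
    using spaced_des_le[OF Cons.prems] by simp
  then show ?case
    using Cons by (simp add: spaced_Cons del: des.simps)
qed simp

lemma des_or_hd_pos: "0 < des w \<or> 0 < hd (w @ [1])"
  by (induction w) auto

lemma
  assumes "0 < d" "e \<le> 2"
  shows block_part_des: "block (part (p + d * des (e # w)) e) = p + d * des (e # w)"
    and letter_part_des: "letter (part (p + d * des (e # w)) e) = e"
proof -
  have "0 < p + d * des (e # w) + e"
    using des_or_hd_pos[of "e # w"] assms(1) by (auto simp del: des.simps)
  then show "block (part (p + d * des (e # w)) e) = p + d * des (e # w)"
    "letter (part (p + d * des (e # w)) e) = e"
    using assms(2) by (simp_all only: block_part letter_part)
qed

lemma map_letter_assemble:
  assumes "0 < d" "length w = length ps" "set w \<subseteq> {..2}"
  shows "map letter (assemble d w ps) = w"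
  using assms(2,3)
  by (induction w ps rule: list_induct2)
    (auto simp: letter_part_des[OF assms(1)] simp del: des.simps)

lemma excess_assemble:
  assumes "0 < d" "length w = length ps" "set w \<subseteq> {..2}"
  shows "excess d (assemble d w ps) = ps"
  using assms(2,3)
proof (induction w ps rule: list_induct2)
  case (Cons e w p ps)
  then have "map letter (assemble d (e # w) (p # ps)) = e # w"
    by (intro map_letter_assemble[OF assms(1)]) auto
  then show ?case
    using Cons by (simp add: block_part_des[OF assms(1)] del: des.simps)
qed simp

lemma spaced_assemble:
  assumes "0 < d" "length w = length ps" "set w \<subseteq> {..2}" "sorted_wrt (\<ge>) ps"
  shows "spaced d (assemble d w ps)"
  using assms(2-)
proof (induction w ps rule: list_induct2)
  case (Cons e w p ps)
  let ?xs = "assemble d w ps"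
  have "letter (hd (?xs @ [0])) = hd (w @ [1])"
    using Cons hd_map_letter[of ?xs] map_letter_assemble[OF assms(1), of w ps] by simp
  moreover have "block (hd (?xs @ [0])) = hd (ps @ [0]) + d * des w"
    using Cons.hyps Cons.prems
    by (cases w; cases ps) (auto simp: block_part_des[OF assms(1)] simp del: des.simps(2))
  moreover have "hd (ps @ [0]) \<le> p" "sorted_wrt (\<ge>) ps" "e \<le> 2"
    using Cons.prems unfolding sorted_desc_Cons_iff by auto
  ultimately have "dominates d (part (p + d * des (e # w)) e) (hd (?xs @ [0]))"
    unfolding dominates_def block_part_des[OF assms(1) \<open>e \<le> 2\<close>] letter_part_des[OF assms(1) \<open>e \<le> 2\<close>]
    by (simp add: algebra_simps)
  then show ?case
    using Cons by (simp add: spaced_Cons del: des.simps)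
qed simp

lemma has_profile_mset:
  "has_profile a b K (mset xs) \<longleftrightarrow> count_list (map letter xs) 2 = a \<and>
    count_list (map letter xs) 0 = b \<and> sum_list (map block xs) = K"
  by (simp add: has_profile_def count_mset sum_mset_sum_list flip: mset_map)

lemma finite_words: "finite (words N a b c)"
  by (rule finite_subset[OF _ finite_lists_length_eq[of "{..2}" N]]) (auto simp: words_def)

lemma finite_desc_lists: "finite (desc_lists N j)"
  by (rule finite_subset[OF _ finite_lists_length_eq[of "{..j}" N]])
    (auto simp: desc_lists_def member_le_sum_list)

lemma card_desc_lists:
  assumes "j \<le> N"
  shows "card (desc_lists N j) = card (partitions j)"
proof -
  have "card (desc_lists N j) = card {ps. sorted_wrt (\<ge>) ps \<and> 0 \<notin> set ps \<and> sum_list ps = j}"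
    unfolding desc_lists_def using size_le_sum_mset[of "mset _"] assms
    by (intro card_sorted_desc_pad_zeros[symmetric])
      (auto simp: sum_list_replicate sum_mset_sum_list intro: le_trans)
  also have "\<dots> = card (partitions j)"
    unfolding partitions_def card_sorted_desc_lists[symmetric] by (simp add: sum_mset_sum_list)
  finally show ?thesis .
qed

lemma spaced_list_decomposition:
  assumes "has_profile a b K (mset xs)" "spaced d xs"
  shows "\<exists>c j. map letter xs \<in> words (length xs) a b c \<and> excess d xs \<in> desc_lists (length xs) j \<and>
    d * c + j = K"
  using assms sum_list_block[OF assms(2)] sorted_desc_excess[OF assms(2)] letter_le_2
  by (auto simp: words_def desc_lists_def has_profile_mset)

lemma assemble_words:
  assumes "0 < d" "w \<in> words N a b c" "p \<in> desc_lists N j"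
  shows "map letter (assemble d w p) = w" "excess d (assemble d w p) = p"
    "spaced d (assemble d w p)"
    "length (assemble d w p) = N" "has_profile a b (d * c + j) (mset (assemble d w p))"
proof -
  let ?xs = "assemble d w p"
  show xs: "map letter ?xs = w" "excess d ?xs = p" "spaced d ?xs"
    using assms map_letter_assemble[of d w p] excess_assemble[of d w p] spaced_assemble[of d w p]
    by (simp_all add: words_def desc_lists_def)
  show "length ?xs = N"
    using arg_cong[OF xs(1), of length] assms(2) by (simp add: words_def)
  show "has_profile a b (d * c + j) (mset ?xs)"
    using assms sum_list_block[OF xs(3)] xs
    by (simp add: words_def desc_lists_def has_profile_mset)
qed

lemma card_spaced_lists:
  assumes "0 < d"
  shows "card {xs. length xs = N \<and> has_profile a b K (mset xs) \<and> spaced d xs} =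
    (\<Sum>c\<le>K div d. card (words N a b c) * card (desc_lists N (K - d * c)))"
proof (rule card_weighted_decomposition[where weight = comaj and join = "assemble d"
      and f = "map letter" and g = "excess d"])
  show "\<exists>c j. map letter xs \<in> words N a b c \<and> excess d xs \<in> desc_lists N j \<and> d * c + j = K"
    if "xs \<in> {xs. length xs = N \<and> has_profile a b K (mset xs) \<and> spaced d xs}" for xs
    using spaced_list_decomposition that by blast
  show "map letter (assemble d w p) = w \<and> excess d (assemble d w p) = p"
    if "w \<in> words N a b c" "p \<in> desc_lists N j" for c j w p
    using assemble_words[OF assms that] by simp
  show "assemble d w p \<in> {xs. length xs = N \<and> has_profile a b K (mset xs) \<and> spaced d xs}"
    if "w \<in> words N a b c" "p \<in> desc_lists N j" "d * c + j = K" for c j w p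
    using assemble_words[OF assms that(1,2)] that(3) by simp
  show "comaj w = c" if "w \<in> words N a b c" for c w
    using that by (simp add: words_def)
qed (simp_all add: assms finite_words finite_desc_lists assemble_excess)

lemma card_spaced_partitions:
  assumes "0 < d" "3 * K + a \<le> N"
  shows "card (spaced_partitions d a b K) =
    (\<Sum>c\<le>K div d. card (words N a b c) * card (partitions (K - d * c)))"
proof -
  define Q where "Q xs \<longleftrightarrow> has_profile a b K (mset xs) \<and> spaced d xs" for xs
  have sorted: "sorted_wrt (\<ge>) xs \<and> R \<and> Q xs \<longleftrightarrow> R \<and> Q xs" for xs R
    using spaced_imp_sorted_desc[OF assms(1)] by (auto simp: Q_def)
  have "card (spaced_partitions d a b K) = card {ps. sorted_wrt (\<ge>) ps \<and> 0 \<notin> set ps \<and> Q ps}"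
    unfolding sorted by (simp add: spaced_partitions_def Q_def)
  also have "\<dots> = card {xs. sorted_wrt (\<ge>) xs \<and> length xs = N \<and> Q xs}"
  proof (rule card_sorted_desc_pad_zeros)
    show "Q (ps @ replicate m 0) \<longleftrightarrow> Q ps" for ps m
      by (simp add: Q_def spaced_append_zeros has_profile_add_zeros)
    show "length ps \<le> N" if "0 \<notin> set ps" "Q ps" for ps
      using size_le_sum_mset[of "mset ps"] that has_profile_imp_sum[of a b K "mset ps"] assms(2)
      by (simp add: Q_def sum_mset_sum_list)
  qed
  also have "\<dots> = card {xs. length xs = N \<and> has_profile a b K (mset xs) \<and> spaced d xs}"
    unfolding sorted by (simp add: Q_def)
  also have "\<dots> = (\<Sum>c\<le>K div d. card (words N a b c) * card (partitions (K - d * c)))"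
    unfolding card_spaced_lists[OF assms(1)] using assms(2) by (simp add: card_desc_lists)
  finally show ?thesis .
qed

lemma card_scaled_partitions_1_eq:
  "card (scaled_partitions 1 a b K) = card (spaced_partitions 1 a b K)"
proof -
  have "scaled_partitions 1 a b K = {M. 0 \<notin># M \<and> has_profile a b K M}"
    by (simp add: scaled_partitions_def)
  moreover have "spaced_partitions 1 a b K =
      {ps. sorted_wrt (\<ge>) ps \<and> 0 \<notin># mset ps \<and> has_profile a b K (mset ps)}"
    by (auto simp: spaced_partitions_def spaced_1_iff simp del: One_nat_def)
  ultimately show ?thesis
    using card_sorted_desc_lists[of "\<lambda>M. 0 \<notin># M \<and> has_profile a b K M"] by simp
qed

theorem card_scaled_partitions_eq_card_spaced_partitions:
  assumes "0 < d"
  shows "card (scaled_partitions d a b K) = card (spaced_partitions d a b K)"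
proof -
  define N where "N = 3 * K + a"
  have "card (nonneutral_multisets a b c) = card (words N a b c)" if "c \<le> K" for c
  proof (rule convolution_cancel[OF _ _ that])
    show "card (partitions 0) \<noteq> 0"
      by (simp add: partitions_0)
    show "(\<Sum>c\<le>k. card (nonneutral_multisets a b c) * card (partitions (k - c))) =
        (\<Sum>c\<le>k. card (words N a b c) * card (partitions (k - c)))" if "k \<le> K" for k
      using card_scaled_partitions_1_eq[of a b k] card_scaled_partitions[of 1 a b k]
        card_spaced_partitions[of 1 k a N b] that by (simp add: N_def)
  qed
  moreover have "c \<le> K" if "c \<le> K div d" for c
    using that div_le_dividend le_trans by blast
  ultimately show ?thesis
    by (simp add: card_scaled_partitions card_spaced_partitions[of d K a N] assms N_def)
qed


section \<open>The two partition functions\<close>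

lemma is_partition_iff: "is_partition n ps \<longleftrightarrow> sorted_wrt (\<ge>) ps \<and> 0 \<notin> set ps \<and> sum_list ps = n"
  unfolding is_partition_def by (metis gr0I less_irrefl)

lemma num_parts_mod_3:
  "num_parts_mod 3 1 ps = count_list (map letter ps) 2"
  "num_parts_mod 3 2 ps = count_list (map letter ps) 0"
  unfolding num_parts_mod_def letter_eq_2_iff[symmetric] letter_eq_0_iff[symmetric]
  by (induction ps) auto

lemma sum_list_num_parts_mod_3:
  "sum_list ps + num_parts_mod 3 2 ps = 3 * sum_list (map block ps) + num_parts_mod 3 1 ps"
  using sum_mset_eq_block_sum[of "mset ps"]
  by (simp add: num_parts_mod_3[simplified] count_mset sum_mset_sum_list flip: mset_map)

lemma is_partition_profile_iff:
  assumes "n + b = 3 * K + a"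
  shows "is_partition n ps \<and> num_parts_mod 3 1 ps = a \<and> num_parts_mod 3 2 ps = b \<longleftrightarrow>
    sorted_wrt (\<ge>) ps \<and> 0 \<notin> set ps \<and> has_profile a b K (mset ps)"
  using sum_list_num_parts_mod_3[of ps] assms
  unfolding is_partition_iff has_profile_mset num_parts_mod_3 by auto

lemma C1_conv_mod_3:
  "C1 a b n = card {ps. is_partition n ps \<and> num_parts_mod 3 1 ps = a \<and> num_parts_mod 3 2 ps = b \<and>
    (\<forall>x\<in>set ps. letter x = 1 \<or> 2 dvd block x)}"
proof -
  have mod6: "x mod 6 \<in> {0, 1, 3, 5} \<longleftrightarrow> letter x = 1 \<or> 2 dvd block x" for x
    unfolding block_def letter_def by simp presburger
  have "num_parts_mod 6 1 ps = num_parts_mod 3 1 ps" "num_parts_mod 6 5 ps = num_parts_mod 3 2 ps"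
    if "\<forall>x\<in>set ps. x mod 6 \<in> {0, 1, 3, 5}" for ps
  proof -
    have "x mod 6 = 1 \<longleftrightarrow> x mod 3 = 1" "x mod 6 = 5 \<longleftrightarrow> x mod 3 = 2"
      if "x mod 6 \<in> {0, 1, 3, 5}" for x :: nat
      using that by simp_all presburger+
    then show "num_parts_mod 6 1 ps = num_parts_mod 3 1 ps"
      "num_parts_mod 6 5 ps = num_parts_mod 3 2 ps"
      using that unfolding num_parts_mod_def
      by (auto intro!: arg_cong[where f = length] filter_cong)
  qed
  then show ?thesis
    unfolding C1_def mod6[symmetric] by (intro arg_cong[where f = card] Collect_cong) metis
qed

lemma C1_eq_card_scaled_partitions:
  assumes "n + b = 3 * K + a"
  shows "C1 a b n = card (scaled_partitions 2 a b K)"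
proof -
  have "C1 a b n = card {ps. sorted_wrt (\<ge>) ps \<and> 0 \<notin># mset ps \<and> has_profile a b K (mset ps) \<and>
      (\<forall>x\<in>#mset ps. letter x = 1 \<or> 2 dvd block x)}"
    unfolding C1_conv_mod_3 using is_partition_profile_iff[OF assms]
    by (intro arg_cong[where f = card] Collect_cong) auto
  also have "\<dots> = card (scaled_partitions 2 a b K)"
    unfolding scaled_partitions_def by (rule card_sorted_desc_lists)
  finally show ?thesis .
qed

lemma dominates_2_iff:
  assumes "y \<le> x"
  shows "dominates 2 x y \<longleftrightarrow> (x = y + 1 \<longrightarrow> y mod 3 \<noteq> 1) \<and> (x = y + 2 \<longrightarrow> y mod 3 = 2)"
proof -
  have "letter x = 0 \<or> letter x = 1 \<or> letter x = 2" "letter y = 0 \<or> letter y = 1 \<or> letter y = 2"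
    using letter_le_2[of x] letter_le_2[of y] by auto
  then show ?thesis
    unfolding letter_eq_2_iff[symmetric] letter_eq_0_iff[symmetric] dominates_def
    using block_letter[of x] block_letter[of y] assms
    by (elim disjE) (simp_all, presburger+)
qed

lemma spaced_2_iff:
  assumes "sorted_wrt (\<ge>) ps"
  shows "spaced 2 ps \<longleftrightarrow> (\<forall>j. Suc j < length ps \<longrightarrow>
      (ps ! j = ps ! Suc j + 1 \<longrightarrow> ps ! Suc j mod 3 \<noteq> 1) \<and>
      (ps ! j = ps ! Suc j + 2 \<longrightarrow> ps ! Suc j mod 3 = 2)) \<and> 2 \<notin> set ps"
proof -
  have "dominates 2 x 0 \<longleftrightarrow> x \<noteq> 2" for x
    using dominates_2_iff[of 0 x] by (simp add: numeral_2_eq_2)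
  moreover have "dominates 2 (ps ! j) (ps ! Suc j) \<longleftrightarrow>
      (ps ! j = ps ! Suc j + 1 \<longrightarrow> ps ! Suc j mod 3 \<noteq> 1) \<and>
      (ps ! j = ps ! Suc j + 2 \<longrightarrow> ps ! Suc j mod 3 = 2)" if "Suc j < length ps" for j
    using assms that by (intro dominates_2_iff) (simp add: sorted_wrt_iff_nth_less)
  ultimately show ?thesis
    by (auto simp: spaced_def sorted_wrt_append sorted_wrt_iff_nth_Suc_transp[OF transp_dominates])
qed

lemma C2_conv_spaced:
  "C2 a b n = card {ps. is_partition n ps \<and> num_parts_mod 3 1 ps = a \<and> num_parts_mod 3 2 ps = b \<and>
    spaced 2 ps}"
  unfolding C2_def using spaced_2_iff
  by (intro arg_cong[where f = card] Collect_cong) (auto simp only: is_partition_iff)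

lemma C2_eq_card_spaced_partitions:
  assumes "n + b = 3 * K + a"
  shows "C2 a b n = card (spaced_partitions 2 a b K)"
  unfolding C2_conv_spaced spaced_partitions_def
  using is_partition_profile_iff[OF assms] spaced_imp_sorted_desc[of 2]
  by (intro arg_cong[where f = card] Collect_cong) auto

theorem theorem3p3:
  fixes n m1 m2 :: nat
  shows "C1 m1 m2 n = C2 m1 m2 n"
proof (cases "\<exists>K. n + m2 = 3 * K + m1")
  case True
  then obtain K where K: "n + m2 = 3 * K + m1"
    by blast
  have "C1 m1 m2 n = card (scaled_partitions 2 m1 m2 K)"
    by (rule C1_eq_card_scaled_partitions[OF K])
  also have "\<dots> = card (spaced_partitions 2 m1 m2 K)"
    by (rule card_scaled_partitions_eq_card_spaced_partitions) simp
  also have "\<dots> = C2 m1 m2 n"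
    by (rule C2_eq_card_spaced_partitions[OF K, symmetric])
  finally show ?thesis .
next
  case False
  then have "\<not> (is_partition n ps \<and> num_parts_mod 3 1 ps = m1 \<and> num_parts_mod 3 2 ps = m2)" for ps
    using sum_list_num_parts_mod_3[of ps] by (auto simp: is_partition_iff)
  then show ?thesis
    unfolding C1_conv_mod_3 C2_conv_spaced by (metis (mono_tags, lifting))
qed

end
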